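(* Let $N\ge 3$. For $p,q,m,s>0$ consider the system $$ (S)\quad \begin{cases} -\Delta u=\dfrac{u^p}{v^q} & \text{in }\mathbb{R}^N,\\[2mm] -\Delta v=\dfrac{u^m}{v^s} & \text{in }\mathbb{R}^N,\\[2mm] u(x),v(x)\to 0 & \text{as }|x|\to\infty. \end{cases} $$ (i) If $0<p<\frac{N+2}{N-2}$, then $(S)$ has no positive radial solutions for all $q,m,s>0$. (ii) Conversely, for all $p>\frac{N+2}{N-2}$ there exist $q,m,s>0$ such that $(S)$ has a positive radial solution.
   Context: A positive solution is a pair of functions $u,v\in C^2(\mathbb{R}^N)$ with $u,v>0$ satisfying the system at every point of $\mathbb{R}^N$ together with the decay condition at infinity; it is radial if both $u$ and $v$ are radially symmetric about the origin. *)

theory Defs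
  imports "HOL-Analysis.Analysis"
begin

definition partial_deriv :: "'n::finite \<Rightarrow> (real ^ 'n \<Rightarrow> real) \<Rightarrow> real ^ 'n \<Rightarrow> real" where
  "partial_deriv i f x = deriv (\<lambda>t. f (x + t *\<^sub>R axis i 1)) 0"

(* deriv is only meaningful where the derivative exists, so C^k regularity has to
   ask for that separately. *)
definition has_partial :: "'n::finite \<Rightarrow> (real ^ 'n \<Rightarrow> real) \<Rightarrow> bool" where
  "has_partial i f \<longleftrightarrow>
     (\<forall>x. (\<lambda>t. f (x + t *\<^sub>R axis i 1)) field_differentiable (at 0))"

(* C^k on the whole space: all partial derivatives of order at most k, mixed ones
   included, exist everywhere and are continuous. *)
primrec C_k :: "nat \<Rightarrow> (real ^ 'n::finite \<Rightarrow> real) \<Rightarrow> bool" where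
  "C_k 0 f \<longleftrightarrow> continuous_on UNIV f"
| "C_k (Suc k) f \<longleftrightarrow>
     continuous_on UNIV f \<and> (\<forall>i. has_partial i f \<and> C_k k (partial_deriv i f))"

definition laplacian :: "(real ^ 'n::finite \<Rightarrow> real) \<Rightarrow> real ^ 'n \<Rightarrow> real" where
  "laplacian f x = (\<Sum>i\<in>UNIV. partial_deriv i (partial_deriv i f) x)"

definition radial :: "(real ^ 'n::finite \<Rightarrow> real) \<Rightarrow> bool" where
  "radial f \<longleftrightarrow> (\<forall>x y. norm x = norm y \<longrightarrow> f x = f y)"

definition positive_solution ::
  "real \<Rightarrow> real \<Rightarrow> real \<Rightarrow> real \<Rightarrow> (real ^ 'n::finite \<Rightarrow> real) \<Rightarrow> (real ^ 'n \<Rightarrow> real) \<Rightarrow> bool" where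
  "positive_solution p q m s u v \<longleftrightarrow>
     C_k 2 u \<and> C_k 2 v \<and>
     (\<forall>x. u x > 0 \<and> v x > 0) \<and>
     (\<forall>x. - laplacian u x = u x powr p / v x powr q) \<and>
     (\<forall>x. - laplacian v x = u x powr m / v x powr s) \<and>
     (u \<longlongrightarrow> 0) at_infinity \<and> (v \<longlongrightarrow> 0) at_infinity"

definition positive_radial_solution ::
  "real \<Rightarrow> real \<Rightarrow> real \<Rightarrow> real \<Rightarrow> (real ^ 'n::finite \<Rightarrow> real) \<Rightarrow> (real ^ 'n \<Rightarrow> real) \<Rightarrow> bool" where
  "positive_radial_solution p q m s u v \<longleftrightarrow>
     positive_solution p q m s u v \<and> radial u \<and> radial v"

end

theory Submission
  imports Defs
begin

text \<open>For a radial solution, \<open>v\<close> is radially decreasing, so \<open>u\<close> solves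
  \<open>- \<Delta>u = K u\<^sup>p\<close> with the radially nondecreasing weight \<open>K = v\<^sup>-\<^sup>q\<close>. The Pohozaev function of this
  equation vanishes at the origin and, for subcritical \<open>p\<close>, is strictly increasing in \<open>r\<close>. On the
  other hand, monotonicity of the flux \<open>- r\<^sup>N\<^sup>-\<^sup>1 u'\<close> bounds it by a multiple of \<open>r\<^sup>N\<^sup>-\<^sup>2 u\<^sup>2\<close>, and the same
  estimates give \<open>r\<^sup>2 u\<^sup>p\<^sup>-\<^sup>1\<close> bounded, which with \<open>u \<rightarrow> 0\<close> forces \<open>r\<^sup>N\<^sup>-\<^sup>2 u\<^sup>2 \<rightarrow> 0\<close>: a contradiction.
  Conversely, for supercritical \<open>p\<close> one takes \<open>u = v\<close> to be the Aubin-Talenti bubble solving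
  \<open>- \<Delta>U = U\<^sup>\<sigma>\<close> with \<open>\<sigma> = (N + 2) / (N - 2)\<close>, and \<open>q = p - \<sigma>\<close>, \<open>m = 1 + \<sigma>\<close>, \<open>s = 1\<close>.\<close>

section \<open>Superharmonic radial profiles: flux, slope and doubling estimates\<close>

text \<open>The radial form of \<open>- \<Delta>f = S\<close> in dimension \<open>N = d + 2\<close>.\<close>

locale radial_ode =
  fixes d :: nat and f f' S :: "real \<Rightarrow> real"
  assumes deriv_f: "\<And>r. r > 0 \<Longrightarrow> (f has_real_derivative f' r) (at r)"
    and deriv_f': "\<And>r. r > 0 \<Longrightarrow>
      (f' has_real_derivative - (real d + 1) / r * f' r - S r) (at r)"
    and cont_f': "continuous_on {0..} f'"
    and source_pos: "\<And>r. r > 0 \<Longrightarrow> S r > 0"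
begin

text \<open>Up to the area of the unit sphere, the flux of \<open>- grad f\<close> through the
  sphere of radius \<open>r\<close>; the power \<open>d + 1 = N - 1\<close> cancels the first-order
  term of the equation.\<close>

definition flux :: "real \<Rightarrow> real" where
  "flux r = r ^ (d + 1) * (- f' r)"

lemma deriv_flux:
  assumes "r > 0"
  shows "(flux has_real_derivative r ^ (d + 1) * S r) (at r)"
  unfolding flux_def
  by (rule derivative_eq_intros deriv_f' assms refl)+ (use assms in \<open>simp add: field_simps\<close>)

lemma cont_flux: "continuous_on {0..} flux"
  unfolding flux_def by (intro continuous_intros cont_f')

text \<open>Continuity of \<open>f'\<close> up to the origin admits \<open>a = 0\<close>. Since
  \<open>flux 0 = 0\<close>, this is how regularity at the origin fixes the sign of
  \<open>f'\<close>.\<close>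

lemma flux_less:
  assumes "0 \<le> a" "a < b"
  shows "flux a < flux b"
proof (rule DERIV_pos_imp_increasing_open[OF assms(2)])
  fix x assume x: "a < x" "x < b"
  with assms have "x > 0" by simp
  then show "\<exists>y. (flux has_real_derivative y) (at x) \<and> 0 < y"
    using deriv_flux[of x] source_pos[of x] by (intro exI[of _ "x ^ (d + 1) * S x"]) simp
qed (use assms in \<open>auto intro: continuous_on_subset[OF cont_flux]\<close>)

lemma f'_neg:
  assumes "r > 0"
  shows "f' r < 0"
proof -
  have "flux 0 < flux r" using flux_less[of 0 r] assms by simp
  then have "0 < r ^ (d + 1) * (- f' r)" by (simp add: flux_def)
  then show ?thesis using assms by (simp add: zero_less_mult_iff mult_less_0_iff)
qed

lemma f_mono:
  assumes "0 < a" "a \<le> b"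
  shows "f b \<le> f a"
proof (rule DERIV_nonpos_imp_nonincreasing[OF assms(2)])
  fix x assume "a \<le> x" "x \<le> b"
  then have "x > 0" using assms by simp
  then show "\<exists>y. (f has_real_derivative y) (at x) \<and> y \<le> 0"
    using deriv_f[of x] f'_neg[of x] by (intro exI[of _ "f' x"]) simp
qed

lemma mvt_f:
  assumes "r > 0"
  obtains \<xi> where "r < \<xi>" "\<xi> < 2 * r" "f r - f (2 * r) = r * (- f' \<xi>)"
proof -
  have "\<exists>z>r. z < 2 * r \<and> f (2 * r) - f r = (2 * r - r) * f' z"
    using assms by (intro MVT2) (auto intro: deriv_f)
  then show ?thesis using that by (auto simp: algebra_simps)
qed

text \<open>As the flux increases, the slope at \<open>r\<close> is at most
  \<open>2 ^ (d + 1)\<close> times the slope anywhere between \<open>r\<close> and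
  \<open>2 * r\<close>, and by the mean value theorem one of those slopes is
  \<open>(f r - f (2 * r)) / r\<close>.\<close>

lemma slope_le:
  assumes "r > 0" "f (2 * r) \<ge> 0"
  shows "r * (- f' r) \<le> 2 ^ (d + 1) * f r"
proof -
  obtain \<xi> where \<xi>: "r < \<xi>" "\<xi> < 2 * r" "f r - f (2 * r) = r * (- f' \<xi>)"
    using mvt_f[OF assms(1)] .
  have neg: "- f' \<xi> > 0" using f'_neg[of \<xi>] \<xi> assms by simp
  have "r ^ (d + 1) * (- f' r) \<le> \<xi> ^ (d + 1) * (- f' \<xi>)"
    using flux_less[of r \<xi>] \<xi> assms by (simp add: flux_def)
  also have "\<dots> \<le> (2 * r) ^ (d + 1) * (- f' \<xi>)"
    using \<xi> assms neg by (intro mult_right_mono power_mono) auto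
  also have "\<dots> = r ^ (d + 1) * (2 ^ (d + 1) * (- f' \<xi>))"
    by (simp only: power_mult_distrib mult_ac)
  finally have "- f' r \<le> 2 ^ (d + 1) * (- f' \<xi>)"
    using assms by (subst (asm) mult_le_cancel_left_pos) auto
  then have "r * (- f' r) \<le> r * (2 ^ (d + 1) * (- f' \<xi>))"
    using assms by (intro mult_left_mono) auto
  also have "\<dots> = 2 ^ (d + 1) * (f r - f (2 * r))"
    unfolding \<xi>(3) by (simp only: mult_ac)
  also have "\<dots> \<le> 2 ^ (d + 1) * f r" using assms by (intro mult_left_mono) auto
  finally show ?thesis .
qed

text \<open>A Harnack-type inequality: flux monotonicity, read towards larger radii, bounds the
  slope inside the annulus by the slope at \<open>2 * r\<close>, which \<open>slope_le\<close> at
  \<open>2 * r\<close> bounds by \<open>f (2 * r)\<close>.\<close>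

lemma doubling:
  assumes "r > 0" "f (4 * r) \<ge> 0"
  shows "f r \<le> (1 + 2 ^ (2 * d + 1)) * f (2 * r)"
proof -
  obtain \<xi> where \<xi>: "r < \<xi>" "\<xi> < 2 * r" "f r - f (2 * r) = r * (- f' \<xi>)"
    using mvt_f[OF assms(1)] .
  have neg: "- f' \<xi> > 0" using f'_neg[of \<xi>] \<xi> assms by simp
  have "r ^ (d + 1) * (- f' \<xi>) \<le> \<xi> ^ (d + 1) * (- f' \<xi>)"
    using \<xi> assms neg by (intro mult_right_mono power_mono) auto
  also have "\<dots> \<le> (2 * r) ^ (d + 1) * (- f' (2 * r))"
    using flux_less[of \<xi> "2 * r"] \<xi> assms by (simp add: flux_def)
  also have "\<dots> = r ^ (d + 1) * (2 ^ (d + 1) * (- f' (2 * r)))"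
    by (simp only: power_mult_distrib mult_ac)
  finally have "- f' \<xi> \<le> 2 ^ (d + 1) * (- f' (2 * r))"
    using assms by (subst (asm) mult_le_cancel_left_pos) auto
  then have "r * (- f' \<xi>) \<le> r * (2 ^ (d + 1) * (- f' (2 * r)))"
    using assms by (intro mult_left_mono) auto
  also have "\<dots> = 2 ^ d * ((2 * r) * (- f' (2 * r)))" by simp
  also have "\<dots> \<le> 2 ^ d * (2 ^ (d + 1) * f (2 * r))"
    using slope_le[of "2 * r"] assms by (intro mult_left_mono) auto
  also have "\<dots> = 2 ^ (2 * d + 1) * f (2 * r)" by (simp add: power_add power_even_eq power2_eq_square)
  finally show ?thesis using \<xi>(3) by (simp add: algebra_simps)
qed

end

section \<open>The weighted Emden-Fowler equation and its Pohozaev function\<close>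

locale weighted_emden_fowler = radial_ode d f f' "\<lambda>r. K r * f r powr p"
  for d f f' and K K' :: "real \<Rightarrow> real" and p :: real +
  assumes p_pos: "p > 0"
    and f_pos: "\<And>r. f r > 0"
    and cont_f: "continuous_on {0..} f"
    and K_pos: "\<And>r. K r > 0"
    and cont_K: "continuous_on {0..} K"
    and deriv_K: "\<And>r. r > 0 \<Longrightarrow> (K has_real_derivative K' r) (at r)"
    and K'_nonneg: "\<And>r. r > 0 \<Longrightarrow> K' r \<ge> 0"
begin

lemma K_mono:
  assumes "0 < a" "a \<le> b"
  shows "K a \<le> K b"
proof (rule DERIV_nonneg_imp_nondecreasing[OF assms(2)])
  fix x assume "a \<le> x" "x \<le> b"
  then have "x > 0" using assms by simp
  then show "\<exists>y. (K has_real_derivative y) (at x) \<and> 0 \<le> y"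
    using deriv_K[of x] K'_nonneg[of x] by (intro exI[of _ "K' x"]) simp
qed

definition doubling_const :: real where
  "doubling_const = 1 + 2 ^ (2 * d + 1)"

definition source_const :: real where
  "source_const = 2 ^ (2 * d + 1) * doubling_const powr p"

lemma doubling_const_pos: "doubling_const > 0"
  by (simp add: doubling_const_def add_pos_pos)

lemma source_const_pos: "source_const > 0"
  using doubling_const_pos by (simp add: source_const_def)

text \<open>The flux gained on the annulus between \<open>r\<close> and \<open>2 * r\<close> is at most the flux through its outer
  boundary, which the slope bound controls by \<open>f\<close>.\<close>

lemma source_le:
  assumes "r > 0"
  shows "r ^ 2 * (K r * f r powr p) \<le> source_const * f r"
proof -
  have "\<exists>z>r. z < 2 * r \<and>
      flux (2 * r) - flux r = (2 * r - r) * (z ^ (d + 1) * (K z * f z powr p))"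
    using assms by (intro MVT2 deriv_flux) auto
  then obtain \<xi> where \<xi>: "r < \<xi>" "\<xi> < 2 * r"
    and eq: "flux (2 * r) - flux r = r * (\<xi> ^ (d + 1) * (K \<xi> * f \<xi> powr p))"
    by auto
  \<comment> \<open>On the annulus \<open>f\<close> is at least \<open>f (2 * r)\<close>, which
    doubling compares with \<open>f r\<close>; the loss enters \<open>source_const\<close> as
    \<open>doubling_const powr p\<close>.\<close>
  have C: "f r / doubling_const \<le> f (2 * r)"
    using doubling[folded doubling_const_def, OF assms] f_pos[of "4 * r"] doubling_const_pos
    by (simp add: field_simps)
  have "r * (r ^ (d + 1) * (K r * (f r / doubling_const) powr p))
      \<le> r * (\<xi> ^ (d + 1) * (K \<xi> * f \<xi> powr p))"
  proof (intro mult_left_mono mult_mono power_mono powr_mono2)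
    show "f r / doubling_const \<le> f \<xi>"
      using C f_mono[of \<xi> "2 * r"] \<xi> assms by simp
    show "K r \<le> K \<xi>" using K_mono[of r \<xi>] \<xi> assms by simp
  qed (use \<xi> assms p_pos f_pos K_pos doubling_const_pos in \<open>auto intro!: mult_nonneg_nonneg intro: less_imp_le\<close>)
  also have "\<dots> \<le> flux (2 * r)"
    using eq flux_less[of 0 r] assms by (simp add: flux_def)
  also have "\<dots> = (2 * r) ^ d * ((2 * r) * (- f' (2 * r)))"
    by (simp add: flux_def)
  also have "\<dots> \<le> (2 * r) ^ d * (2 ^ (d + 1) * f (2 * r))"
    using slope_le[of "2 * r"] assms f_pos by (intro mult_left_mono) (auto intro: less_imp_le)
  also have "\<dots> \<le> (2 * r) ^ d * (2 ^ (d + 1) * f r)"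
    using f_mono[of r "2 * r"] assms by (intro mult_left_mono) auto
  also have "\<dots> = r ^ d * (2 ^ (2 * d + 1) * f r)"
    by (simp add: power_add power_even_eq power2_eq_square power_mult_distrib)
  finally have "r ^ d * (r ^ 2 * (K r * (f r / doubling_const) powr p))
      \<le> r ^ d * (2 ^ (2 * d + 1) * f r)"
    by (simp add: power2_eq_square mult_ac)
  then have "r ^ 2 * (K r * (f r / doubling_const) powr p) \<le> 2 ^ (2 * d + 1) * f r"
    using assms by (subst (asm) mult_le_cancel_left_pos) auto
  moreover have "(f r / doubling_const) powr p = f r powr p / doubling_const powr p"
    by (rule powr_divide)
  ultimately show ?thesis
    using doubling_const_pos by (simp add: source_const_def field_simps)
qed

text \<open>\<open>r ^ N\<close> times the energy density plus a multiple of \<open>f * f'\<close>;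
  the coefficient \<open>d / 2 = (N - 2) / 2\<close> is the one that removes \<open>f' ^ 2\<close>
  from the derivative.\<close>

definition pohozaev :: "real \<Rightarrow> real" where
  "pohozaev r = r ^ (d + 2) * (f' r ^ 2 / 2 + K r * (f r powr (p + 1) / (p + 1)))
     + d / 2 * r ^ (d + 1) * f r * f' r"

lemma powr_f_Suc: "f r powr (p + 1) = f r powr p * f r"
  using f_pos[of r] by (simp add: powr_add)

text \<open>Inserting the equation for \<open>f''\<close> cancels every term with \<open>f'\<close>.
  For \<open>d > 0\<close> the remaining factor \<open>(d + 2) / (p + 1) - d / 2\<close> is positive
  exactly for \<open>p < (d + 4) / d = (N + 2) / (N - 2)\<close>.\<close>

lemma deriv_pohozaev:
  assumes "r > 0"
  shows "(pohozaev has_real_derivative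
     r ^ (d + 1) * K r * f r powr (p + 1) * ((d + 2) / (p + 1) - d / 2)
     + r ^ (d + 2) * K' r * f r powr (p + 1) / (p + 1)) (at r)"
proof -
  have p: "p + 1 \<noteq> 0" using p_pos by simp
  let ?F = "f r powr p"
  define X where "X = - (real d + 1) / r * f' r - K r * ?F"
  have f': "(f' has_real_derivative X) (at r)"
    using deriv_f'[OF assms] by (simp add: X_def)
  have V: "((\<lambda>x. f x powr (p + 1) / (p + 1)) has_real_derivative ?F * f' r) (at r)"
    using DERIV_cdivide[OF DERIV_fun_powr[OF deriv_f[OF assms] f_pos, of "p + 1"], of "p + 1"] p
    by simp
  have E: "((\<lambda>x. f' x ^ 2 / 2) has_real_derivative f' r * X) (at r)"
    using DERIV_cdivide[OF DERIV_power[OF f', of 2], of 2]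
    by (simp add: mult.commute)
  have P: "((\<lambda>r. r ^ (d + 2)) has_real_derivative (real d + 2) * r ^ (d + 1)) (at r)"
    "((\<lambda>r. r ^ (d + 1)) has_real_derivative (real d + 1) * r ^ d) (at r)"
    using DERIV_pow[of "d + 2" r] DERIV_pow[of "d + 1" r] by (simp_all add: add_ac)
  have D: "((\<lambda>r. B r * (e r + K r * W r) + d / 2 * A r * f r * f' r) has_real_derivative
        B' * (e r + K r * W r) + B r * (e' + (K' r * W r + K r * w))
        + d / 2 * (A' * f r * f' r + A r * f' r * f' r + A r * f r * X)) (at r)"
    if "(A has_real_derivative A') (at r)"
      "(B has_real_derivative B') (at r)" "(e has_real_derivative e') (at r)"
      "(W has_real_derivative w) (at r)"
    for A B e W and A' B' e' w :: real
    by (rule that refl derivative_eq_intros deriv_f f' deriv_K assms)+ (simp add: algebra_simps)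
  note D = D[OF P(2,1) E V, folded pohozaev_def]
  \<comment> \<open>Multiplying the second derivative \<open>X\<close> by \<open>r\<close> clears
    the singular coefficient \<open>1 / r\<close>.\<close>
  have rX: "r * X = - (real d + 1) * f' r - r * K r * ?F"
    using assms by (simp add: X_def right_diff_distrib)
  have BX: "r ^ (d + 2) * X = - (real d + 1) * r ^ (d + 1) * f' r - r ^ (d + 2) * K r * ?F"
    and AX: "r ^ (d + 1) * X = - (real d + 1) * r ^ d * f' r - r ^ (d + 1) * K r * ?F"
    using arg_cong[OF rX, of "(*) (r ^ (d + 1))"] arg_cong[OF rX, of "(*) (r ^ d)"]
    by (simp_all add: algebra_simps)
  \<comment> \<open>With \<open>A\<close>, \<open>B\<close>, \<open>C\<close> for
    \<open>r ^ (d + 1)\<close>, \<open>r ^ (d + 2)\<close>, \<open>r ^ d\<close>, the cancellation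
    is a polynomial identity that uses the equation through \<open>B * X\<close> and
    \<open>A * X\<close> alone.\<close>
  have "(real d + 2) * A * (y ^ 2 / 2 + k * G) + B * (y * X + (k' * G + k * (F * y)))
      + d / 2 * ((real d + 1) * C * g * y + A * y * y + A * g * X)
      = A * k * G * (real d + 2) - A * k * (F * g) * (d / 2) + B * k' * G"
    if BX: "B * X = - (real d + 1) * A * y - B * k * F"
      and AX: "A * X = - (real d + 1) * C * y - A * k * F"
    for A B C F G g k k' y :: real
  proof -
    have e: "B * (y * X + (k' * G + k * (F * y))) = y * (B * X) + B * k' * G + B * k * F * y"
      "A * g * X = g * (A * X)"
      by (simp_all add: algebra_simps)
    show ?thesis
      unfolding e BX AX by (simp add: algebra_simps power2_eq_square)
  qed
  note eq = this[OF BX AX]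
  show ?thesis
    using D unfolding eq unfolding powr_f_Suc by (simp add: algebra_simps)
qed

text \<open>The function starts at \<open>0\<close> and strictly increases. Radius \<open>1\<close>
  is an arbitrary choice; it supplies a fixed positive level to set against the decay.\<close>

lemma pohozaev_lower_bound:
  assumes "p < (real d + 4) / real d" "d > 0"
  shows "pohozaev 1 > 0" and "\<And>r. r \<ge> 1 \<Longrightarrow> pohozaev 1 \<le> pohozaev r"
proof -
  have coeff: "(d + 2) / (p + 1) - d / 2 > 0"
    using assms p_pos by (simp add: field_simps)
  have pos: "r ^ (d + 1) * K r * f r powr (p + 1) * ((d + 2) / (p + 1) - d / 2)
     + r ^ (d + 2) * K' r * f r powr (p + 1) / (p + 1) > 0" if "r > 0" for r
    using coeff that K_pos[of r] f_pos[of r] K'_nonneg[of r] p_pos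
    by (intro add_pos_nonneg mult_pos_pos) auto
  have inc: "pohozaev a < pohozaev b" if "0 \<le> a" "a < b" for a b
  proof (rule DERIV_pos_imp_increasing_open[OF that(2)])
    fix x assume "a < x" "x < b"
    then have "x > 0" using that by simp
    then show "\<exists>y. (pohozaev has_real_derivative y) (at x) \<and> 0 < y"
      using deriv_pohozaev[of x] pos[of x] by blast
  next
    have "continuous_on {0..} pohozaev"
      unfolding pohozaev_def using f_pos p_pos
      by (intro continuous_intros cont_f cont_f' cont_K) (auto simp: less_imp_neq[symmetric])
    then show "continuous_on {a..b} pohozaev"
      by (rule continuous_on_subset) (use that in auto)
  qed
  show "pohozaev 1 > 0" using inc[of 0 1] by (simp add: pohozaev_def)
  show "pohozaev 1 \<le> pohozaev r" if "r \<ge> 1" for r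
    using inc[of 1 r] that by (cases "r = 1") auto
qed

definition pohozaev_const :: real where
  "pohozaev_const = (2 ^ (d + 1)) ^ 2 / 2 + source_const / (p + 1)"

text \<open>The mixed term is nonpositive and is dropped. Both \<open>r * f'\<close> and
  \<open>r ^ 2 * K * f powr p\<close> are of order \<open>f\<close>, by \<open>slope_le\<close> and
  \<open>source_le\<close>; these give the two summands of \<open>pohozaev_const\<close>.\<close>

lemma pohozaev_le:
  assumes "r > 0"
  shows "pohozaev r \<le> pohozaev_const * (r ^ d * f r ^ 2)"
proof -
  have "d / 2 * r ^ (d + 1) * f r * f' r \<le> 0"
    using assms f_pos[of r] f'_neg[OF assms] by (intro mult_nonneg_nonpos) auto
  moreover have "(r * (- f' r)) ^ 2 \<le> (2 ^ (d + 1) * f r) ^ 2"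
    using slope_le[OF assms] f_pos[of "2 * r"] f'_neg[OF assms] assms
    by (intro power_mono) (auto simp: mult_nonneg_nonpos less_imp_le)
  then have "r ^ d * ((r * (- f' r)) ^ 2 / 2) \<le> r ^ d * ((2 ^ (d + 1) * f r) ^ 2 / 2)"
    using assms by (intro mult_left_mono divide_right_mono) auto
  moreover have "r ^ d * (r ^ 2 * (K r * f r powr p) * f r / (p + 1))
      \<le> r ^ d * (source_const * f r * f r / (p + 1))"
    using source_le[OF assms] assms p_pos f_pos[of r]
    by (intro mult_left_mono divide_right_mono mult_right_mono) (auto intro: less_imp_le)
  moreover have "pohozaev r = r ^ d * ((r * (- f' r)) ^ 2 / 2)
      + r ^ d * (r ^ 2 * (K r * f r powr p) * f r / (p + 1)) + d / 2 * r ^ (d + 1) * f r * f' r"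
    unfolding pohozaev_def powr_f_Suc
    by (simp add: power_add power2_eq_square algebra_simps)
  ultimately show ?thesis
    by (simp add: pohozaev_const_def algebra_simps power2_eq_square)
qed

text \<open>This is \<open>source_le\<close> divided by \<open>f r\<close>, with the nondecreasing
  weight bounded below by \<open>K 1\<close>.\<close>

lemma f_powr_decay:
  assumes "r \<ge> 1"
  shows "f r powr (p - 1) \<le> source_const / K 1 * r powr -2"
proof -
  have "r ^ 2 * K 1 * f r powr (p - 1) * f r = r ^ 2 * (K 1 * f r powr p)"
    using f_pos[of r] by (simp add: powr_diff)
  also have "\<dots> \<le> r ^ 2 * (K r * f r powr p)"
    using K_mono[of 1 r] assms by (intro mult_left_mono mult_right_mono) auto
  also have "\<dots> \<le> source_const * f r" using source_le[of r] assms by simp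
  finally have "r ^ 2 * K 1 * f r powr (p - 1) \<le> source_const"
    using f_pos[of r] by (simp add: mult_le_cancel_right_pos)
  then show ?thesis
    using assms K_pos[of 1] by (simp add: powr_minus field_simps powr_numeral)
qed

theorem no_decaying_solution:
  assumes p: "p < (real d + 4) / real d" and d: "d > 0" and lim: "(f \<longlongrightarrow> 0) at_top"
  shows False
proof (cases "p \<le> 1")
  \<comment> \<open>Here \<open>f powr (p - 1)\<close> is at least 1 as soon as
    \<open>f < 1\<close>, whereas \<open>f_powr_decay\<close> sends it to 0.\<close>
  case True
  have "((\<lambda>r. source_const / K 1 * r powr -2) \<longlongrightarrow> source_const / K 1 * 0) at_top"
    by (intro tendsto_mult_left tendsto_neg_powr filterlim_ident) auto
  from order_tendstoD(2)[OF this, of 1]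
  have "\<forall>\<^sub>F r in at_top. source_const / K 1 * r powr -2 < 1" by simp
  moreover have "\<forall>\<^sub>F r in at_top. f r < 1" using lim by (rule order_tendstoD) simp
  ultimately have "\<forall>\<^sub>F r::real in at_top. False"
    using eventually_ge_at_top[of 1]
  proof eventually_elim
    case (elim r)
    have "f r powr 0 \<le> f r powr (p - 1)"
      using f_pos[of r] elim(2) True by (intro powr_mono') auto
    with f_powr_decay[OF elim(3)] elim(1) f_pos[of r] show ?case by simp
  qed
  then show False by simp
next
  case False
  define C where "C = source_const / K 1"
  \<comment> \<open>Raising \<open>f_powr_decay\<close> to the power \<open>2 / (p - 1)\<close>
    bounds \<open>r ^ d * f r ^ 2\<close> by a multiple of \<open>r powr - e\<close>; subcriticality
    is \<open>e > 0\<close>.\<close>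
  define e where "e = 4 / (p - 1) - d"
  have C: "C > 0" using source_const_pos K_pos by (simp add: C_def)
  have e: "e > 0" using p d False by (simp add: e_def field_simps)
  have bound: "r ^ d * f r ^ 2 \<le> C powr (2 / (p - 1)) * r powr - e" if r: "r \<ge> 1" for r
  proof -
    have "f r ^ 2 = (f r powr (p - 1)) powr (2 / (p - 1))"
    proof -
      have "(p - 1) * (2 / (p - 1)) = 2"
        using nonzero_mult_div_cancel_left[of "p - 1" 2] False by (simp only: times_divide_eq_right)
      then show ?thesis using f_pos[of r] by (simp only: powr_powr) (simp add: powr_numeral)
    qed
    also have "\<dots> \<le> (C * r powr -2) powr (2 / (p - 1))"
      using f_powr_decay[OF r] False by (intro powr_mono2) (auto simp: C_def)
    also have "\<dots> = C powr (2 / (p - 1)) * r powr (- 4 / (p - 1))"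
      using C by (simp add: powr_mult powr_powr)
    finally have "r ^ d * f r ^ 2 \<le> r ^ d * (C powr (2 / (p - 1)) * r powr (- 4 / (p - 1)))"
      using r by (intro mult_left_mono) auto
    also have "\<dots> = C powr (2 / (p - 1)) * (r powr d * r powr (- 4 / (p - 1)))"
      using r by (simp add: powr_realpow)
    also have "r powr d * r powr (- 4 / (p - 1)) = r powr - e"
      by (simp add: powr_add[symmetric] e_def)
    finally show ?thesis .
  qed
  \<comment> \<open>The upper bound on the Pohozaev function tends to 0 and so drops below
    \<open>pohozaev 1\<close>, which is impossible.\<close>
  have "((\<lambda>r. pohozaev_const * (C powr (2 / (p - 1)) * r powr - e)) \<longlongrightarrow>
      pohozaev_const * (C powr (2 / (p - 1)) * 0)) at_top"
    using e by (intro tendsto_mult_left tendsto_neg_powr filterlim_ident) auto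
  from order_tendstoD(2)[OF this, of "pohozaev 1"]
  have "\<forall>\<^sub>F r in at_top. pohozaev_const * (C powr (2 / (p - 1)) * r powr - e) < pohozaev 1"
    using pohozaev_lower_bound(1)[OF p d] by simp
  then have "\<forall>\<^sub>F r::real in at_top. False"
    using eventually_ge_at_top[of 1]
  proof eventually_elim
    case (elim r)
    have "pohozaev_const \<ge> 0"
      using source_const_pos p_pos by (simp add: pohozaev_const_def)
    then have "pohozaev r \<le> pohozaev_const * (C powr (2 / (p - 1)) * r powr - e)"
      using pohozaev_le[of r] bound[OF elim(2)] elim(2)
        mult_left_mono[OF bound[OF elim(2)], of pohozaev_const] by linarith
    with pohozaev_lower_bound(2)[OF p d elim(2)] elim(1) show ?case by simp
  qed
  then show False by simp
qed

end

section \<open>Reduction of radial solutions to the ordinary differential equation\<close>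

text \<open>Partial derivatives are defined at parameter 0; moving the base point along the line
  gives the derivative at every parameter \<open>t\<close>.\<close>

lemma has_partial_along_axis:
  assumes "has_partial i f"
  shows "((\<lambda>t. f (y + t *\<^sub>R axis i 1)) has_real_derivative
    partial_deriv i f (y + t *\<^sub>R axis i 1)) (at t)"
proof -
  let ?F = "\<lambda>t. f (y + t *\<^sub>R axis i 1)"
  have "((\<lambda>h. f ((y + t *\<^sub>R axis i 1) + h *\<^sub>R axis i 1)) has_real_derivative
      partial_deriv i f (y + t *\<^sub>R axis i 1)) (at 0)"
    using assms unfolding has_partial_def partial_deriv_def
    by (simp add: DERIV_deriv_iff_field_differentiable)
  then have "((\<lambda>h. ?F (h + t)) has_real_derivative
      partial_deriv i f (y + t *\<^sub>R axis i 1)) (at 0)"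
    by (simp add: algebra_simps)
  then show ?thesis
    using DERIV_shift[of ?F "partial_deriv i f (y + t *\<^sub>R axis i 1)" 0 t] by simp
qed

lemma C_k_2_D:
  assumes "C_k 2 f"
  shows "continuous_on UNIV f" "has_partial i f"
    "continuous_on UNIV (partial_deriv i f)" "has_partial j (partial_deriv i f)"
  using assms by (auto simp: numeral_2_eq_2)

lemma C_k_2_I:
  assumes "continuous_on UNIV f" "\<And>i. has_partial i f"
    "\<And>i. continuous_on UNIV (partial_deriv i f)" "\<And>i j. has_partial j (partial_deriv i f)"
    "\<And>i j. continuous_on UNIV (partial_deriv j (partial_deriv i f))"
  shows "C_k 2 f"
  using assms by (simp add: numeral_2_eq_2)

lemma continuous_on_along_axis:
  fixes f :: "real ^ 'n::finite \<Rightarrow> real"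
  assumes "continuous_on UNIV f"
  shows "continuous_on A (\<lambda>t. f (t *\<^sub>R axis k 1))"
  by (rule continuous_on_compose2[OF assms]) (auto intro!: continuous_intros)

text \<open>Along the line through \<open>r * e\<^sub>k\<close> in an orthogonal direction, \<open>f\<close> depends on \<open>sqrt (r\<^sup>2 + t\<^sup>2)\<close>
  only, so its derivative there is \<open>t\<close> times a continuous function.\<close>

lemma partial2_radial_orthogonal:
  fixes f :: "real ^ 'n::finite \<Rightarrow> real"
  assumes f: "C_k 2 f" "radial f" and "i \<noteq> k" "r > 0"
  shows "partial_deriv i (partial_deriv i f) (r *\<^sub>R axis k 1)
    = partial_deriv k f (r *\<^sub>R axis k 1) / r"
proof -
  let ?f' = "\<lambda>t. partial_deriv k f (t *\<^sub>R axis k 1)"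
  let ?\<rho> = "\<lambda>t. sqrt (r\<^sup>2 + t\<^sup>2)"
  let ?z = "\<lambda>t. r *\<^sub>R axis k 1 + t *\<^sub>R axis i (1::real)"
  have pos: "r\<^sup>2 + t\<^sup>2 > 0" for t using assms by (simp add: add_pos_nonneg)
  have fz: "f (?z t) = f (?\<rho> t *\<^sub>R axis k 1)" for t
  proof -
    have "norm (?z t) = ?\<rho> t"
      using assms by (simp add: norm_eq_sqrt_inner inner_add_left inner_add_right
          inner_axis_axis power2_eq_square)
    then show ?thesis
      using f(2) pos[of t] unfolding radial_def by (auto intro!: less_imp_le)
  qed
  have d: "partial_deriv i f (?z t) = ?f' (?\<rho> t) / ?\<rho> t * t" for t
  proof -
    have "((\<lambda>t. f (?z t)) has_real_derivative partial_deriv i f (?z t)) (at t)"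
      by (rule has_partial_along_axis[OF C_k_2_D(2)[OF f(1)]])
    moreover have "((\<lambda>s. f (s *\<^sub>R axis k 1)) has_real_derivative ?f' s) (at s)" for s
      using has_partial_along_axis[OF C_k_2_D(2)[OF f(1)], where y = 0] by simp
    then have "((\<lambda>t. f (?\<rho> t *\<^sub>R axis k 1)) has_real_derivative ?f' (?\<rho> t) * (t / ?\<rho> t)) (at t)"
      using pos[of t]
      by (intro DERIV_chain2[where f = "\<lambda>s. f (s *\<^sub>R axis k 1)"])
        (auto intro!: derivative_eq_intros simp: field_simps)
    ultimately show ?thesis
      unfolding fz by (auto dest: DERIV_unique)
  qed
  have "((\<lambda>t. partial_deriv i f (?z t)) has_real_derivative
      partial_deriv i (partial_deriv i f) (?z 0)) (at 0)"
    by (rule has_partial_along_axis[OF C_k_2_D(4)[OF f(1)]])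
  \<comment> \<open>In Caratheodory's form the derivative at 0 is the value there of the factor
    multiplying \<open>t\<close>, so continuity of that factor suffices.\<close>
  moreover have "((\<lambda>t. partial_deriv i f (?z t)) has_real_derivative ?f' (?\<rho> 0) / ?\<rho> 0) (at 0)"
    unfolding CARAT_DERIV
  proof (intro exI conjI allI)
    have "continuous_on UNIV (\<lambda>t. ?f' (?\<rho> t) / ?\<rho> t)"
      using pos by (intro continuous_intros continuous_on_compose2[OF C_k_2_D(3)[OF f(1)]])
        (auto simp: less_imp_neq[symmetric] add_nonneg_eq_0_iff)
    then show "isCont (\<lambda>t. ?f' (?\<rho> t) / ?\<rho> t) 0" by (simp add: continuous_on_eq_continuous_at)
  qed (simp_all only: d, simp_all)
  ultimately show ?thesis
    using assms by (auto dest: DERIV_unique)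
qed

text \<open>Each of the \<open>N - 1\<close> directions orthogonal to axis \<open>k\<close>
  contributes the radial derivative divided by \<open>r\<close>.\<close>

lemma laplacian_radial:
  fixes f :: "real ^ 'n::finite \<Rightarrow> real"
  assumes "C_k 2 f" "radial f" "r > 0"
  shows "laplacian f (r *\<^sub>R axis k 1) =
    partial_deriv k (partial_deriv k f) (r *\<^sub>R axis k 1)
    + (real CARD('n) - 1) / r * partial_deriv k f (r *\<^sub>R axis k 1)"
proof -
  let ?x = "r *\<^sub>R axis k (1::real) :: real ^ 'n"
  have "laplacian f ?x = partial_deriv k (partial_deriv k f) ?x
      + (\<Sum>i\<in>UNIV - {k}. partial_deriv i (partial_deriv i f) ?x)"
    unfolding laplacian_def by (rule sum.remove) auto
  also have "(\<Sum>i\<in>UNIV - {k}. partial_deriv i (partial_deriv i f) ?x)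
      = (\<Sum>i\<in>UNIV - {k}. partial_deriv k f ?x / r)"
    by (intro sum.cong partial2_radial_orthogonal) (use assms in auto)
  also have "\<dots> = (real CARD('n) - 1) / r * partial_deriv k f ?x"
    by (simp add: card_Diff_subset of_nat_diff Suc_leI)
  finally show ?thesis .
qed

lemma radial_ode_of_solution:
  fixes f :: "real ^ 'n::finite \<Rightarrow> real"
  assumes f: "C_k 2 f" "radial f" and d: "CARD('n) = d + 2"
    and S: "\<And>x. - laplacian f x = S x" "\<And>x. S x > 0"
  shows "radial_ode d (\<lambda>t. f (t *\<^sub>R axis k 1)) (\<lambda>t. partial_deriv k f (t *\<^sub>R axis k 1))
    (\<lambda>t. S (t *\<^sub>R axis k 1))"
proof
  fix r :: real assume r: "r > 0"
  show "((\<lambda>t. f (t *\<^sub>R axis k 1)) has_real_derivative partial_deriv k f (r *\<^sub>R axis k 1)) (at r)"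
    using has_partial_along_axis[OF C_k_2_D(2)[OF f(1)], where y = 0] by simp
  have "((\<lambda>t. partial_deriv k f (t *\<^sub>R axis k 1)) has_real_derivative
      partial_deriv k (partial_deriv k f) (r *\<^sub>R axis k 1)) (at r)"
    using has_partial_along_axis[OF C_k_2_D(4)[OF f(1)], where y = 0] by simp
  moreover have "partial_deriv k (partial_deriv k f) (r *\<^sub>R axis k 1) =
      - (real d + 1) / r * partial_deriv k f (r *\<^sub>R axis k 1) - S (r *\<^sub>R axis k 1)"
    using laplacian_radial[OF f r, of k] S(1)[of "r *\<^sub>R axis k 1"] d
    by (simp add: left_diff_distrib diff_divide_distrib distrib_right add_divide_distrib)
  ultimately show "((\<lambda>t. partial_deriv k f (t *\<^sub>R axis k 1)) has_real_derivative
      - (real d + 1) / r * partial_deriv k f (r *\<^sub>R axis k 1) - S (r *\<^sub>R axis k 1)) (at r)"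
    by simp
qed (use S(2) continuous_on_along_axis[OF C_k_2_D(3)[OF f(1)]] in simp_all)

lemma no_subcritical_radial_solution:
  fixes u v :: "real ^ 'n::finite \<Rightarrow> real"
  assumes n: "CARD('n) \<ge> 3" and p: "0 < p" "p < (real CARD('n) + 2) / (real CARD('n) - 2)"
    and q: "q > 0" and sol: "positive_radial_solution p q m s u v"
  shows False
proof -
  obtain d where d: "CARD('n) = d + 2" "d > 0"
    using n by (intro that[of "CARD('n) - 2"]) auto
  have u: "C_k 2 u" "radial u" and v: "C_k 2 v" "radial v"
    and pos: "\<And>x. u x > 0" "\<And>x. v x > 0"
    and eqs: "\<And>x. - laplacian u x = u x powr p / v x powr q"
      "\<And>x. - laplacian v x = u x powr m / v x powr s"
    and lim: "(u \<longlongrightarrow> 0) at_infinity"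
    using sol by (auto simp: positive_radial_solution_def positive_solution_def)
  \<comment> \<open>By radial symmetry any axis represents the solution.\<close>
  define k :: 'n where "k = undefined"
  let ?e = "axis k (1::real) :: real ^ 'n"
  let ?f = "\<lambda>t. u (t *\<^sub>R ?e)" and ?f' = "\<lambda>t. partial_deriv k u (t *\<^sub>R ?e)"
  let ?g = "\<lambda>t. v (t *\<^sub>R ?e)" and ?g' = "\<lambda>t. partial_deriv k v (t *\<^sub>R ?e)"
  let ?K = "\<lambda>t. ?g t powr - q" and ?K' = "\<lambda>t. - q * ?g t powr (- q - 1) * ?g' t"
  have ne: "u x \<noteq> 0" "v x \<noteq> 0" for x
    using pos[of x] by simp_all
  \<comment> \<open>The second equation serves to give \<open>?g' < 0\<close>, which makes the
    weight \<open>?K\<close> nondecreasing.\<close>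
  have G: "radial_ode d ?g ?g' (\<lambda>t. u (t *\<^sub>R ?e) powr m / v (t *\<^sub>R ?e) powr s)"
  proof (rule radial_ode_of_solution[OF v d(1), of "\<lambda>x. u x powr m / v x powr s"])
    show "u x powr m / v x powr s > 0" for x using ne[of x] by simp
  qed (rule eqs(2))
  have F: "radial_ode d ?f ?f' (\<lambda>t. ?K t * ?f t powr p)"
  proof (rule radial_ode_of_solution[OF u d(1), of "\<lambda>x. v x powr - q * u x powr p"])
    show "- laplacian u x = v x powr - q * u x powr p" for x
      using eqs(1)[of x] by (simp add: powr_minus_divide)
    show "v x powr - q * u x powr p > 0" for x using ne[of x] by simp
  qed
  have cont: "continuous_on {0..} ?f" "continuous_on {0..} ?g"
    using C_k_2_D(1)[OF u(1)] C_k_2_D(1)[OF v(1)] by (simp_all add: continuous_on_along_axis)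
  have "weighted_emden_fowler_axioms ?f ?K ?K' p"
  proof (rule weighted_emden_fowler_axioms.intro)
    fix r :: real assume r: "r > 0"
    show "(?K has_real_derivative ?K' r) (at r)"
      using DERIV_fun_powr[OF radial_ode.deriv_f[OF G r], of "- q"] pos(2) by simp
    show "?K' r \<ge> 0"
      using q radial_ode.f'_neg[OF G r] by (intro mult_nonpos_nonpos[OF mult_nonpos_nonneg]) auto
  next
    show "continuous_on {0..} ?K"
      using ne(2) by (intro continuous_on_powr cont(2) continuous_on_const) simp
    show "?f t > 0" "?K t > 0" for t using pos ne(2) by simp_all
    show "p > 0" by (rule p(1))
    show "continuous_on {0..} ?f" by (rule cont(1))
  qed
  with F have W: "weighted_emden_fowler d ?f ?f' ?K ?K' p"
    by (rule weighted_emden_fowler.intro)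
  have "filterlim (\<lambda>t. t *\<^sub>R ?e) at_infinity at_top"
    by (rule filterlim_norm_at_top_imp_at_infinity) (simp add: filterlim_abs_real)
  then have "(?f \<longlongrightarrow> 0) at_top"
    by (rule filterlim_compose[OF lim])
  moreover have "p < (real d + 4) / real d" using p d by (simp add: add.commute)
  ultimately show False using weighted_emden_fowler.no_decaying_solution[OF W] d(2) by blast
qed

section \<open>The Aubin-Talenti bubble and supercritical solutions\<close>

text \<open>The exponent is left free because each differentiation lowers it by one;
  \<open>x \<bullet> x\<close> instead of a norm makes the base a quadratic polynomial along every
  axis.\<close>

definition bubble :: "real \<Rightarrow> real ^ 'n::finite \<Rightarrow> real" where
  "bubble b x = (1 + x \<bullet> x) powr b"

lemma one_plus_inner_pos: "1 + x \<bullet> x > 0" for x :: "real ^ 'n::finite"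
  by (simp add: add_pos_nonneg)

lemma bubble_add: "bubble (a + b) x = bubble a x * bubble b x"
  by (simp add: bubble_def powr_add)

lemma deriv_bubble:
  "((\<lambda>t. bubble b (x + t *\<^sub>R axis i 1)) has_real_derivative 2 * b * x $ i * bubble (b - 1) x) (at 0)"
proof -
  have eq: "1 + (x + t *\<^sub>R axis i 1) \<bullet> (x + t *\<^sub>R axis i 1) = 1 + x \<bullet> x + 2 * t * x $ i + t ^ 2" for t
    by (simp add: inner_add_left inner_add_right inner_axis inner_axis' inner_axis_axis
        power2_eq_square algebra_simps)
  have "((\<lambda>t. 1 + x \<bullet> x + 2 * t * x $ i + t ^ 2) has_real_derivative 2 * x $ i) (at 0)"
    by (auto intro!: derivative_eq_intros)
  from DERIV_fun_powr[OF this, of b] show ?thesis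
    unfolding bubble_def eq using one_plus_inner_pos[of x] by (simp add: mult_ac)
qed

lemma continuous_on_bubble: "continuous_on A (bubble b :: real ^ 'n::finite \<Rightarrow> real)"
proof -
  have "1 + x \<bullet> x \<noteq> 0" for x :: "real ^ 'n"
    using one_plus_inner_pos[of x] by simp
  then show ?thesis
    unfolding bubble_def[abs_def] by (intro continuous_intros) auto
qed

text \<open>The derivative is arranged as a constant times \<open>x $ i * bubble (b - 1) x\<close>,
  the shape differentiated next, so that the two rules chain by rewriting.\<close>

lemma
  fixes A :: real
  shows has_partial_bubble: "has_partial i (\<lambda>x. A * bubble b x)"
    and partial_bubble: "partial_deriv i (\<lambda>x. A * bubble b x) = (\<lambda>x. 2 * b * A * (x $ i * bubble (b - 1) x))"
proof -
  have D: "((\<lambda>t. A * bubble b (x + t *\<^sub>R axis i 1)) has_real_derivative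
      2 * b * A * (x $ i * bubble (b - 1) x)) (at 0)" for x
    using DERIV_cmult[OF deriv_bubble[of b x i], of A] by (simp add: mult_ac)
  show "has_partial i (\<lambda>x. A * bubble b x)"
    unfolding has_partial_def field_differentiable_def using D by blast
  show "partial_deriv i (\<lambda>x. A * bubble b x) = (\<lambda>x. 2 * b * A * (x $ i * bubble (b - 1) x))"
    unfolding partial_deriv_def using DERIV_imp_deriv[OF D] by blast
qed

lemma
  fixes A :: real
  shows has_partial_coord_bubble: "has_partial j (\<lambda>x. A * (x $ i * bubble b x))"
    and partial_coord_bubble: "partial_deriv j (\<lambda>x. A * (x $ i * bubble b x)) =
      (\<lambda>x. A * (of_bool (i = j) * bubble b x + 2 * b * x $ i * x $ j * bubble (b - 1) x))"
      (is "_ = ?R")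
proof -
  have D: "((\<lambda>t. A * ((x + t *\<^sub>R axis j 1) $ i * bubble b (x + t *\<^sub>R axis j 1))) has_real_derivative
      ?R x) (at 0)" for x
  proof -
    have "((\<lambda>t. (x + t *\<^sub>R axis j 1) $ i) has_real_derivative of_bool (i = j)) (at 0)"
      by (auto intro!: derivative_eq_intros simp: axis_def)
    from DERIV_cmult[OF DERIV_mult[OF this deriv_bubble[of b x j]], of A] show ?thesis
      by (simp add: mult_ac)
  qed
  show "has_partial j (\<lambda>x. A * (x $ i * bubble b x))"
    unfolding has_partial_def field_differentiable_def using D by blast
  show "partial_deriv j (\<lambda>x. A * (x $ i * bubble b x)) = ?R"
    unfolding partial_deriv_def using DERIV_imp_deriv[OF D] by blast
qed

lemma C_k_2_bubble: "C_k 2 (\<lambda>x. A * bubble b x)"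
  by (rule C_k_2_I)
    (auto simp: partial_bubble partial_coord_bubble has_partial_bubble has_partial_coord_bubble
      intro!: continuous_intros continuous_on_bubble)

lemma laplacian_bubble:
  fixes x :: "real ^ 'n::finite"
  shows "laplacian (\<lambda>x. A * bubble b x) x =
    2 * b * A * (real CARD('n) * bubble (b - 1) x + 2 * (b - 1) * (x \<bullet> x) * bubble (b - 2) x)"
proof -
  have "laplacian (\<lambda>x. A * bubble b x) x =
      (\<Sum>i\<in>UNIV. 2 * b * A * (bubble (b - 1) x + 2 * (b - 1) * bubble (b - 2) x * (x $ i * x $ i)))"
    unfolding laplacian_def partial_bubble partial_coord_bubble
    by (intro sum.cong) (auto simp: algebra_simps)
  also have "\<dots> = 2 * b * A * (real CARD('n) * bubble (b - 1) x
      + 2 * (b - 1) * bubble (b - 2) x * (x \<bullet> x))"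
    by (simp add: sum_distrib_left[symmetric] sum.distrib inner_vec_def)
  finally show ?thesis by (simp add: mult_ac)
qed

lemma bubble_tendsto_0:
  assumes "b < 0"
  shows "((\<lambda>x :: real ^ 'n::finite. bubble b x) \<longlongrightarrow> 0) at_infinity"
proof -
  have "filterlim (\<lambda>x :: real ^ 'n. 1 + norm x ^ 2) at_top at_infinity"
    by (intro filterlim_tendsto_add_at_top[OF tendsto_const] filterlim_pow_at_top
        filterlim_norm_at_top) auto
  then show ?thesis
    unfolding bubble_def power2_norm_eq_inner[symmetric] by (rule tendsto_neg_powr[OF assms])
qed

lemma critical_bubble:
  assumes "CARD('n::finite) \<ge> 3"
  obtains U :: "real ^ 'n \<Rightarrow> real" where "C_k 2 U" "radial U" "\<And>x. U x > 0"
    "\<And>x. - laplacian U x = U x powr ((real CARD('n) + 2) / (real CARD('n) - 2))"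
    "(U \<longlongrightarrow> 0) at_infinity"
proof -
  define N where "N = real CARD('n)"
  have N: "N \<ge> 3" using assms by (simp add: N_def)
  define \<sigma> where "\<sigma> = (N + 2) / (N - 2)"
  \<comment> \<open>The exponent satisfies \<open>b * \<sigma> = b - 2\<close>, matching the powers
    of both sides; \<open>A\<close> is then fixed by
    \<open>A powr (\<sigma> - 1) = N * (N - 2)\<close>, where
    \<open>\<sigma> - 1 = 4 / (N - 2)\<close>.\<close>
  define b where "b = - (N - 2) / 2"
  define A where "A = (N * (N - 2)) powr ((N - 2) / 4)"
  define U :: "real ^ 'n \<Rightarrow> real" where "U = (\<lambda>x. A * bubble b x)"
  have A: "A > 0" using N by (simp add: A_def)
  have b: "b < 0" "b * \<sigma> = b - 2" "2 * b = - (N - 2)" "2 * (b - 1) = - N"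
    using N by (simp_all add: b_def \<sigma>_def field_simps)
  have pos: "U x > 0" for x
    using A one_plus_inner_pos[of x] by (simp add: U_def bubble_def less_imp_neq[symmetric])
  have "(N - 2) / 4 * \<sigma> = 1 + (N - 2) / 4" using N by (simp add: \<sigma>_def field_simps)
  then have A\<sigma>: "A powr \<sigma> = N * (N - 2) * A"
    using N by (simp only: A_def powr_powr powr_add) (simp add: powr_one)
  have "- laplacian U x = U x powr \<sigma>" for x
  proof -
    have "bubble (b - 1) x = bubble (b - 2) x * (1 + x \<bullet> x)"
      using bubble_add[of "b - 2" 1 x] one_plus_inner_pos[of x] by (simp add: bubble_def)
    \<comment> \<open>As \<open>2 * (b - 1) = - N\<close>, the terms
      \<open>N * (1 + x \<bullet> x)\<close> and \<open>- N * (x \<bullet> x)\<close> multiplying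
      \<open>bubble (b - 2) x\<close> add up to the constant \<open>N\<close>.\<close>
    then have "- laplacian U x = N * (N - 2) * A * bubble (b - 2) x"
      unfolding U_def laplacian_bubble N_def[symmetric] b(3,4) by (simp add: algebra_simps)
    also have "\<dots> = A powr \<sigma> * bubble (b * \<sigma>) x"
      by (simp add: A\<sigma> b)
    also have "\<dots> = U x powr \<sigma>"
      using A by (simp add: U_def bubble_def powr_mult powr_powr)
    finally show ?thesis .
  qed
  moreover have "C_k 2 U" by (simp only: U_def C_k_2_bubble)
  moreover have "radial U"
    by (simp add: radial_def U_def bubble_def power2_norm_eq_inner[symmetric])
  moreover have "(U \<longlongrightarrow> 0) at_infinity"
    using tendsto_mult_left[OF bubble_tendsto_0[OF b(1)], of A] by (simp add: U_def)
  ultimately show ?thesis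
    using pos that[of U] unfolding \<sigma>_def N_def by blast
qed

lemma supercritical_radial_solution:
  assumes n: "CARD('n::finite) \<ge> 3" and p: "p > (real CARD('n) + 2) / (real CARD('n) - 2)"
  shows "\<exists>q>0. \<exists>m>0. \<exists>s>0. \<exists>(u :: real ^ 'n \<Rightarrow> real) v. positive_radial_solution p q m s u v"
proof -
  let ?\<sigma> = "(real CARD('n) + 2) / (real CARD('n) - 2)"
  obtain U :: "real ^ 'n \<Rightarrow> real" where U: "C_k 2 U" "radial U" "\<And>x. U x > 0"
    "\<And>x. - laplacian U x = U x powr ?\<sigma>" "(U \<longlongrightarrow> 0) at_infinity"
    using critical_bubble[OF n] by blast
  \<comment> \<open>With \<open>u = v = U\<close> both right-hand sides become
    \<open>U powr ?\<sigma>\<close> once \<open>p - q = ?\<sigma>\<close> and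
    \<open>m - s = ?\<sigma>\<close>; supercriticality is \<open>q > 0\<close>, and
    \<open>s = 1\<close> is a free choice.\<close>
  have "positive_radial_solution p (p - ?\<sigma>) (1 + ?\<sigma>) 1 U U"
    unfolding positive_radial_solution_def positive_solution_def powr_diff[symmetric]
    using U by simp
  moreover have "?\<sigma> > 0" using n by simp
  ultimately show ?thesis
    using p by (intro exI[of _ "p - ?\<sigma>"] exI[of _ "1 + ?\<sigma>"] exI[of _ 1] exI[of _ U] conjI) auto
qed

theorem corollary1p7:
  assumes "CARD('n::finite) \<ge> 3"
  shows "(\<forall>p>0. p < (real CARD('n) + 2) / (real CARD('n) - 2) \<longrightarrow>
            (\<forall>q>0. \<forall>m>0. \<forall>s>0.
               \<nexists>(u :: real ^ 'n \<Rightarrow> real) v. positive_radial_solution p q m s u v))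
       \<and> (\<forall>p > (real CARD('n) + 2) / (real CARD('n) - 2).
            \<exists>q>0. \<exists>m>0. \<exists>s>0.
               \<exists>(u :: real ^ 'n \<Rightarrow> real) v. positive_radial_solution p q m s u v)"
  using no_subcritical_radial_solution supercritical_radial_solution assms by blast

end
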